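(* Let $P=(X,Y,R)$ be a polarity and $U$ an ultrafilter on a set $I$. Define $\theta\colon(P^+)^U\to(P^U)^+$ by $\theta(\alpha^U)=\{f^U\in X^U:\{i\in I: f(i)\in\alpha(i)\}\in U\}$ for $\alpha\in(P^+)^I$. Then $\theta$ is a MacNeille completion of the ultrapower lattice $(P^+)^U$; that is, $\theta$ is a lattice embedding into the complete lattice $(P^U)^+$ whose image is both meet-dense and join-dense in $(P^U)^+$.
   Context: A polarity is a triple $P=(X,Y,R)$ with $R\subseteq X\times Y$. For $A\subseteq X$ let $\rho A=\{y\in Y:\forall x\in A,\ xRy\}$, for $B\subseteq Y$ let $\lambda B=\{x\in X:\forall y\in B,\ xRy\}$; $A$ is stable if $\lambda\rho A=A$. $P^+$ is the complete lattice of stable subsets of $X$ under inclusion (meets are intersections, $\bigvee G=\lambda\rho(\bigcup G)$). The ultrapower $P^U=(X^U,Y^U,R^U)$ has $f^UR^Ug^U$ iff $\{i: f(i)Rg(i)\}\in U$, where $f^U$ is the class of $f$ modulo $f\sim_U g\iff\{i:f(i)=g(i)\}\in U$; $(P^+)^U$ is the lattice ultrapower. A MacNeille completion of a lattice $\mathbb{L}$ is a lattice embedding $e$ of $\mathbb{L}$ into a complete lattice such that every element of the latter is both a meet and a join of elements of $e[\mathbb{L}]$. *)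

theory Defs
  imports "HOL-Algebra.Complete_Lattice" "HOL-Library.FuncSet"
begin

section \<open>Polarities and their lattices of stable sets\<close>

record ('a, 'b) polarity =
  Xset :: "'a set"
  Yset :: "'b set"
  Rel :: "('a \<times> 'b) set"

definition wf_polarity :: "('a, 'b) polarity \<Rightarrow> bool" where
  "wf_polarity P \<longleftrightarrow> Rel P \<subseteq> Xset P \<times> Yset P"

definition rho :: "('a, 'b) polarity \<Rightarrow> 'a set \<Rightarrow> 'b set" where
  "rho P A = {y \<in> Yset P. \<forall>x\<in>A. (x, y) \<in> Rel P}"

definition lam :: "('a, 'b) polarity \<Rightarrow> 'b set \<Rightarrow> 'a set" where
  "lam P B = {x \<in> Xset P. \<forall>y\<in>B. (x, y) \<in> Rel P}"

definition stable :: "('a, 'b) polarity \<Rightarrow> 'a set \<Rightarrow> bool" where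
  "stable P A \<longleftrightarrow> A \<subseteq> Xset P \<and> lam P (rho P A) = A"

definition stable_lattice :: "('a, 'b) polarity \<Rightarrow> 'a set gorder" where
  "stable_lattice P = \<lparr>carrier = {A. stable P A}, eq = (=), le = (\<subseteq>)\<rparr>"


section \<open>Ultrapowers\<close>

locale ultrafilter_on =
  fixes I :: "'i set" and U :: "'i set set"
  assumes subsets: "A \<in> U \<Longrightarrow> A \<subseteq> I"
    and whole: "I \<in> U"
    and proper: "{} \<notin> U"
    and inter: "A \<in> U \<Longrightarrow> B \<in> U \<Longrightarrow> A \<inter> B \<in> U"
    and up: "A \<in> U \<Longrightarrow> A \<subseteq> B \<Longrightarrow> B \<subseteq> I \<Longrightarrow> B \<in> U"
    and ultra: "A \<subseteq> I \<Longrightarrow> A \<in> U \<or> I - A \<in> U"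

text \<open>Elements of \<open>A\<^sup>I\<close> are represented by the extensional functions in \<open>I \<rightarrow>\<^sub>E A\<close>, so
  that two of them are equal iff they agree on \<open>I\<close>.\<close>

definition ultra_rel :: "'i set \<Rightarrow> 'i set set \<Rightarrow> 'a set \<Rightarrow> (('i \<Rightarrow> 'a) \<times> ('i \<Rightarrow> 'a)) set" where
  "ultra_rel I U A =
     {(f, g). f \<in> I \<rightarrow>\<^sub>E A \<and> g \<in> I \<rightarrow>\<^sub>E A \<and> {i \<in> I. f i = g i} \<in> U}"

definition ultra_class :: "'i set \<Rightarrow> 'i set set \<Rightarrow> 'a set \<Rightarrow> ('i \<Rightarrow> 'a) \<Rightarrow> ('i \<Rightarrow> 'a) set" where
  "ultra_class I U A f = ultra_rel I U A `` {f}"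

definition ultrapower_set :: "'i set \<Rightarrow> 'i set set \<Rightarrow> 'a set \<Rightarrow> ('i \<Rightarrow> 'a) set set" where
  "ultrapower_set I U A = (I \<rightarrow>\<^sub>E A) // ultra_rel I U A"

text \<open>The relations below are defined by quantifying existentially over representatives; the
  lemmas \<open>ultrapower_polarity_Rel\<close>, \<open>ultrapower_gorder_le\<close> and \<open>theta_class\<close> show that the choice
  of representatives is immaterial.\<close>

definition ultrapower_polarity ::
  "'i set \<Rightarrow> 'i set set \<Rightarrow> ('a, 'b) polarity \<Rightarrow> (('i \<Rightarrow> 'a) set, ('i \<Rightarrow> 'b) set) polarity" where
  "ultrapower_polarity I U P =
     \<lparr>Xset = ultrapower_set I U (Xset P),
      Yset = ultrapower_set I U (Yset P),
      Rel = {(ultra_class I U (Xset P) f, ultra_class I U (Yset P) g) | f g.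
               f \<in> I \<rightarrow>\<^sub>E Xset P \<and> g \<in> I \<rightarrow>\<^sub>E Yset P \<and> {i \<in> I. (f i, g i) \<in> Rel P} \<in> U}\<rparr>"

text \<open>Lattices are given by their orders, so the ultrapower of a lattice is formed as that of
  an ordered set. Its operations are the ones induced pointwise, see
  \<open>ultrapower_gorder_join\<close> and \<open>ultrapower_gorder_meet\<close>.\<close>

definition ultrapower_gorder ::
  "'i set \<Rightarrow> 'i set set \<Rightarrow> 'a gorder \<Rightarrow> ('i \<Rightarrow> 'a) set gorder" where
  "ultrapower_gorder I U L =
     \<lparr>carrier = ultrapower_set I U (carrier L), eq = (=),
      le = (\<lambda>a b. \<exists>\<alpha>\<in>a. \<exists>\<beta>\<in>b. {i \<in> I. \<alpha> i \<sqsubseteq>\<^bsub>L\<^esub> \<beta> i} \<in> U)\<rparr>"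

definition theta ::
  "'i set \<Rightarrow> 'i set set \<Rightarrow> ('a, 'b) polarity \<Rightarrow> ('i \<Rightarrow> 'a set) set \<Rightarrow> ('i \<Rightarrow> 'a) set set" where
  "theta I U P a =
     {ultra_class I U (Xset P) f | f. f \<in> I \<rightarrow>\<^sub>E Xset P \<and> (\<exists>\<alpha>\<in>a. {i \<in> I. f i \<in> \<alpha> i} \<in> U)}"


section \<open>MacNeille completions\<close>

text \<open>The library predicates \<^const>\<open>join_pres\<close> and \<^const>\<open>meet_pres\<close> include that
  source and target are lattices.\<close>

definition lattice_embedding :: "'a gorder \<Rightarrow> 'b gorder \<Rightarrow> ('a \<Rightarrow> 'b) \<Rightarrow> bool" where
  "lattice_embedding L M e \<longleftrightarrow>
     e \<in> carrier L \<rightarrow> carrier M \<and> inj_on e (carrier L) \<and> join_pres L M e \<and> meet_pres L M e"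

definition MacNeille_completion :: "'a gorder \<Rightarrow> 'b gorder \<Rightarrow> ('a \<Rightarrow> 'b) \<Rightarrow> bool" where
  "MacNeille_completion L M e \<longleftrightarrow>
     complete_lattice M \<and> lattice_embedding L M e \<and>
     (\<forall>m\<in>carrier M. \<exists>S\<subseteq>e ` carrier L. is_glb M m S) \<and>
     (\<forall>m\<in>carrier M. \<exists>S\<subseteq>e ` carrier L. is_lub M m S)"


section \<open>Independence of representatives\<close>

context ultrafilter_on
begin

lemma upI: "A \<in> U \<Longrightarrow> (\<And>i. i \<in> A \<Longrightarrow> i \<in> I \<Longrightarrow> Q i) \<Longrightarrow> {i \<in> I. Q i} \<in> U"
  by (rule up) (use subsets in auto)

lemma up2I:
  assumes "A \<in> U" "B \<in> U" "\<And>i. i \<in> A \<Longrightarrow> i \<in> B \<Longrightarrow> i \<in> I \<Longrightarrow> Q i"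
  shows "{i \<in> I. Q i} \<in> U"
  by (rule upI[OF inter[OF assms(1,2)]]) (use assms(3) in auto)

lemma equiv_ultra_rel: "equiv (I \<rightarrow>\<^sub>E A) (ultra_rel I U A)"
proof (rule equivI)
  show "refl_on (I \<rightarrow>\<^sub>E A) (ultra_rel I U A)"
    using whole by (auto simp: refl_on_def ultra_rel_def)
  show "sym (ultra_rel I U A)"
    by (auto simp: sym_def ultra_rel_def eq_commute)
  show "trans (ultra_rel I U A)"
  proof (rule transI)
    fix f g h assume "(f, g) \<in> ultra_rel I U A" "(g, h) \<in> ultra_rel I U A"
    then have mem: "f \<in> I \<rightarrow>\<^sub>E A" "h \<in> I \<rightarrow>\<^sub>E A"
      and eq: "{i \<in> I. f i = g i} \<in> U" "{i \<in> I. g i = h i} \<in> U"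
      by (simp_all add: ultra_rel_def)
    from eq have "{i \<in> I. f i = h i} \<in> U"
      by (rule up2I) auto
    with mem show "(f, h) \<in> ultra_rel I U A"
      by (simp add: ultra_rel_def)
  qed
  show "ultra_rel I U A \<subseteq> (I \<rightarrow>\<^sub>E A) \<times> (I \<rightarrow>\<^sub>E A)"
    by (auto simp: ultra_rel_def)
qed

lemma ultra_class_self: "f \<in> I \<rightarrow>\<^sub>E A \<Longrightarrow> f \<in> ultra_class I U A f"
  using equiv_ultra_rel unfolding ultra_class_def by (rule equiv_class_self)

lemma ultra_class_in: "f \<in> I \<rightarrow>\<^sub>E A \<Longrightarrow> ultra_class I U A f \<in> ultrapower_set I U A"
  unfolding ultra_class_def ultrapower_set_def by (rule quotientI)

lemma ultrapower_setE:
  assumes "a \<in> ultrapower_set I U A"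
  obtains f where "f \<in> I \<rightarrow>\<^sub>E A" "a = ultra_class I U A f"
  using assms unfolding ultra_class_def ultrapower_set_def by (rule quotientE)

lemma mem_ultra_class:
  "g \<in> ultra_class I U A f \<longleftrightarrow> f \<in> I \<rightarrow>\<^sub>E A \<and> g \<in> I \<rightarrow>\<^sub>E A \<and> {i \<in> I. f i = g i} \<in> U"
  by (auto simp: ultra_class_def ultra_rel_def)

lemma ultra_class_eq_iff:
  assumes "f \<in> I \<rightarrow>\<^sub>E A" "g \<in> I \<rightarrow>\<^sub>E A"
  shows "ultra_class I U A f = ultra_class I U A g \<longleftrightarrow> {i \<in> I. f i = g i} \<in> U"
  using eq_equiv_class_iff[OF equiv_ultra_rel assms] assms
  by (simp add: ultra_class_def ultra_rel_def)

lemma ultrapower_polarity_Rel: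
  assumes "f \<in> I \<rightarrow>\<^sub>E Xset P" "g \<in> I \<rightarrow>\<^sub>E Yset P"
  shows "(ultra_class I U (Xset P) f, ultra_class I U (Yset P) g) \<in> Rel (ultrapower_polarity I U P)
    \<longleftrightarrow> {i \<in> I. (f i, g i) \<in> Rel P} \<in> U" (is "?l \<longleftrightarrow> ?r")
proof
  assume ?l
  then obtain f' g' where fg: "f' \<in> I \<rightarrow>\<^sub>E Xset P" "g' \<in> I \<rightarrow>\<^sub>E Yset P"
    and eq: "ultra_class I U (Xset P) f = ultra_class I U (Xset P) f'"
      "ultra_class I U (Yset P) g = ultra_class I U (Yset P) g'"
    and r: "{i \<in> I. (f' i, g' i) \<in> Rel P} \<in> U"
    by (auto simp: ultrapower_polarity_def)
  have "{i \<in> I. f i = f' i \<and> g i = g' i} \<in> U"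
    using eq unfolding ultra_class_eq_iff[OF assms(1) fg(1)] ultra_class_eq_iff[OF assms(2) fg(2)]
    by (rule up2I) auto
  with r show ?r
    by (rule up2I) auto
qed (use assms in \<open>auto simp: ultrapower_polarity_def\<close>)

lemma wf_ultrapower_polarity: "wf_polarity (ultrapower_polarity I U P)"
  by (auto simp: wf_polarity_def ultrapower_polarity_def intro: ultra_class_in)

lemma theta_class:
  assumes \<alpha>: "\<alpha> \<in> I \<rightarrow>\<^sub>E carrier (stable_lattice P)"
  shows "theta I U P (ultra_class I U (carrier (stable_lattice P)) \<alpha>) =
           {ultra_class I U (Xset P) f | f. f \<in> I \<rightarrow>\<^sub>E Xset P \<and> {i \<in> I. f i \<in> \<alpha> i} \<in> U}"
proof -
  have "(\<exists>\<beta>\<in>ultra_class I U (carrier (stable_lattice P)) \<alpha>. {i \<in> I. f i \<in> \<beta> i} \<in> U)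
      \<longleftrightarrow> {i \<in> I. f i \<in> \<alpha> i} \<in> U" for f
  proof
    assume "\<exists>\<beta>\<in>ultra_class I U (carrier (stable_lattice P)) \<alpha>. {i \<in> I. f i \<in> \<beta> i} \<in> U"
    then obtain \<beta> where "{i \<in> I. f i \<in> \<beta> i} \<in> U" "{i \<in> I. \<alpha> i = \<beta> i} \<in> U"
      by (auto simp: mem_ultra_class)
    then show "{i \<in> I. f i \<in> \<alpha> i} \<in> U"
      by (rule up2I) auto
  qed (rule bexI[OF _ ultra_class_self[OF \<alpha>]])
  then show ?thesis
    by (simp add: theta_def)
qed

lemma theta_mem_iff:
  assumes \<alpha>: "\<alpha> \<in> I \<rightarrow>\<^sub>E carrier (stable_lattice P)" and f: "f \<in> I \<rightarrow>\<^sub>E Xset P"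
  shows "ultra_class I U (Xset P) f \<in> theta I U P (ultra_class I U (carrier (stable_lattice P)) \<alpha>)
    \<longleftrightarrow> {i \<in> I. f i \<in> \<alpha> i} \<in> U"
proof -
  have "{i \<in> I. f i \<in> \<alpha> i} \<in> U"
    if "{i \<in> I. g i \<in> \<alpha> i} \<in> U" "{i \<in> I. f i = g i} \<in> U" for g
    using that by (rule up2I) auto
  then show ?thesis
    using f by (auto simp: theta_class[OF \<alpha>] ultra_class_eq_iff)
qed

lemma ultrapower_gorder_le:
  assumes "\<alpha> \<in> I \<rightarrow>\<^sub>E carrier L" "\<beta> \<in> I \<rightarrow>\<^sub>E carrier L"
  shows "ultra_class I U (carrier L) \<alpha> \<sqsubseteq>\<^bsub>ultrapower_gorder I U L\<^esub> ultra_class I U (carrier L) \<beta>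
    \<longleftrightarrow> {i \<in> I. \<alpha> i \<sqsubseteq>\<^bsub>L\<^esub> \<beta> i} \<in> U" (is "?l \<longleftrightarrow> ?r")
proof
  assume ?l
  then obtain \<alpha>' \<beta>' where *: "{i \<in> I. \<alpha> i = \<alpha>' i} \<in> U" "{i \<in> I. \<beta> i = \<beta>' i} \<in> U"
    and r: "{i \<in> I. \<alpha>' i \<sqsubseteq>\<^bsub>L\<^esub> \<beta>' i} \<in> U"
    by (auto simp: ultrapower_gorder_def mem_ultra_class)
  have "{i \<in> I. \<alpha> i = \<alpha>' i \<and> \<beta> i = \<beta>' i} \<in> U"
    using * by (rule up2I) auto
  with r show ?r
    by (rule up2I) auto
qed (use ultra_class_self assms in \<open>auto simp: ultrapower_gorder_def\<close>)

lemma partial_order_ultrapower_gorder: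
  assumes "partial_order L"
  shows "partial_order (ultrapower_gorder I U L)"
proof -
  interpret L: partial_order L by fact
  let ?M = "ultrapower_gorder I U L"
  have c: "carrier ?M = ultrapower_set I U (carrier L)" and e: "eq ?M = (=)"
    by (auto simp: ultrapower_gorder_def)
  note E = ultrapower_setE[of _ "carrier L"]
  show ?thesis
  proof (unfold_locales, simp_all add: c e)
    fix x assume "x \<in> ultrapower_set I U (carrier L)"
    then obtain f where f: "f \<in> I \<rightarrow>\<^sub>E carrier L" "x = ultra_class I U (carrier L) f" by (rule E)
    show "x \<sqsubseteq>\<^bsub>?M\<^esub> x"
      unfolding f(2) ultrapower_gorder_le[OF f(1) f(1)]
      by (rule upI[OF whole]) (use f(1) in auto)
  next
    fix x y assume le: "x \<sqsubseteq>\<^bsub>?M\<^esub> y" "y \<sqsubseteq>\<^bsub>?M\<^esub> x"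
      and xy: "x \<in> ultrapower_set I U (carrier L)" "y \<in> ultrapower_set I U (carrier L)"
    obtain f where f: "f \<in> I \<rightarrow>\<^sub>E carrier L" "x = ultra_class I U (carrier L) f"
      using xy(1) by (rule E)
    obtain g where g: "g \<in> I \<rightarrow>\<^sub>E carrier L" "y = ultra_class I U (carrier L) g"
      using xy(2) by (rule E)
    show "x = y"
      using le unfolding f(2) g(2) ultra_class_eq_iff[OF f(1) g(1)]
        ultrapower_gorder_le[OF f(1) g(1)] ultrapower_gorder_le[OF g(1) f(1)]
      by (rule up2I) (use f(1) g(1) in auto)
  next
    fix x y z assume le: "x \<sqsubseteq>\<^bsub>?M\<^esub> y" "y \<sqsubseteq>\<^bsub>?M\<^esub> z"
      and xyz: "x \<in> ultrapower_set I U (carrier L)" "y \<in> ultrapower_set I U (carrier L)"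
        "z \<in> ultrapower_set I U (carrier L)"
    obtain f where f: "f \<in> I \<rightarrow>\<^sub>E carrier L" "x = ultra_class I U (carrier L) f"
      using xyz(1) by (rule E)
    obtain g where g: "g \<in> I \<rightarrow>\<^sub>E carrier L" "y = ultra_class I U (carrier L) g"
      using xyz(2) by (rule E)
    obtain h where h: "h \<in> I \<rightarrow>\<^sub>E carrier L" "z = ultra_class I U (carrier L) h"
      using xyz(3) by (rule E)
    show "x \<sqsubseteq>\<^bsub>?M\<^esub> z"
      using le unfolding f(2) g(2) h(2) ultrapower_gorder_le[OF f(1) g(1)]
        ultrapower_gorder_le[OF g(1) h(1)] ultrapower_gorder_le[OF f(1) h(1)]
    proof (rule up2I)
      fix i assume "i \<in> {i \<in> I. f i \<sqsubseteq>\<^bsub>L\<^esub> g i}" "i \<in> {i \<in> I. g i \<sqsubseteq>\<^bsub>L\<^esub> h i}" "i \<in> I"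
      then show "f i \<sqsubseteq>\<^bsub>L\<^esub> h i"
        using L.le_trans[of "f i" "g i" "h i"] PiE_mem[OF f(1)] PiE_mem[OF g(1)] PiE_mem[OF h(1)]
        by simp
    qed
  qed
qed

lemma ultrapower_gorder_is_lub:
  assumes "lattice L" and \<alpha>: "\<alpha> \<in> I \<rightarrow>\<^sub>E carrier L" and \<beta>: "\<beta> \<in> I \<rightarrow>\<^sub>E carrier L"
  shows "is_lub (ultrapower_gorder I U L)
           (ultra_class I U (carrier L) (\<lambda>i\<in>I. \<alpha> i \<squnion>\<^bsub>L\<^esub> \<beta> i))
           {ultra_class I U (carrier L) \<alpha>, ultra_class I U (carrier L) \<beta>}"
proof -
  interpret L: lattice L by fact
  let ?M = "ultrapower_gorder I U L" and ?\<gamma> = "\<lambda>i\<in>I. \<alpha> i \<squnion>\<^bsub>L\<^esub> \<beta> i"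
  let ?c = "ultra_class I U (carrier L)"
  have mem: "\<alpha> i \<in> carrier L" "\<beta> i \<in> carrier L" if "i \<in> I" for i
    using that \<alpha> \<beta> by auto
  have \<gamma>: "?\<gamma> \<in> I \<rightarrow>\<^sub>E carrier L"
    using mem by auto
  have c: "carrier ?M = ultrapower_set I U (carrier L)"
    by (simp add: ultrapower_gorder_def)
  show ?thesis
  proof (rule least_UpperI)
    fix x assume "x \<in> {?c \<alpha>, ?c \<beta>}"
    moreover have "?c \<alpha> \<sqsubseteq>\<^bsub>?M\<^esub> ?c ?\<gamma>"
      unfolding ultrapower_gorder_le[OF \<alpha> \<gamma>]
      by (rule upI[OF whole]) (use mem L.join_left in auto)
    moreover have "?c \<beta> \<sqsubseteq>\<^bsub>?M\<^esub> ?c ?\<gamma>"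
      unfolding ultrapower_gorder_le[OF \<beta> \<gamma>]
      by (rule upI[OF whole]) (use mem L.join_right in auto)
    ultimately show "x \<sqsubseteq>\<^bsub>?M\<^esub> ?c ?\<gamma>" by auto
  next
    fix y assume "y \<in> Upper ?M {?c \<alpha>, ?c \<beta>}"
    then have y: "y \<in> carrier ?M" "?c \<alpha> \<sqsubseteq>\<^bsub>?M\<^esub> y" "?c \<beta> \<sqsubseteq>\<^bsub>?M\<^esub> y"
      using ultra_class_in[OF \<alpha>] ultra_class_in[OF \<beta>] by (auto simp: Upper_def c)
    from y(1) obtain h where h: "h \<in> I \<rightarrow>\<^sub>E carrier L" "y = ?c h"
      unfolding c by (rule ultrapower_setE)
    show "?c ?\<gamma> \<sqsubseteq>\<^bsub>?M\<^esub> y"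
      using y(2,3) unfolding h(2) ultrapower_gorder_le[OF \<alpha> h(1)]
        ultrapower_gorder_le[OF \<beta> h(1)] ultrapower_gorder_le[OF \<gamma> h(1)]
      by (rule up2I) (use h(1) mem in \<open>auto intro!: L.join_le\<close>)
  qed (simp_all add: c ultra_class_in[OF \<alpha>] ultra_class_in[OF \<beta>] ultra_class_in[OF \<gamma>])
qed

lemma ultrapower_gorder_is_glb:
  assumes "lattice L" and \<alpha>: "\<alpha> \<in> I \<rightarrow>\<^sub>E carrier L" and \<beta>: "\<beta> \<in> I \<rightarrow>\<^sub>E carrier L"
  shows "is_glb (ultrapower_gorder I U L)
           (ultra_class I U (carrier L) (\<lambda>i\<in>I. \<alpha> i \<sqinter>\<^bsub>L\<^esub> \<beta> i))
           {ultra_class I U (carrier L) \<alpha>, ultra_class I U (carrier L) \<beta>}"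
proof -
  interpret L: lattice L by fact
  let ?M = "ultrapower_gorder I U L" and ?\<gamma> = "\<lambda>i\<in>I. \<alpha> i \<sqinter>\<^bsub>L\<^esub> \<beta> i"
  let ?c = "ultra_class I U (carrier L)"
  have mem: "\<alpha> i \<in> carrier L" "\<beta> i \<in> carrier L" if "i \<in> I" for i
    using that \<alpha> \<beta> by auto
  have \<gamma>: "?\<gamma> \<in> I \<rightarrow>\<^sub>E carrier L"
    using mem by auto
  have c: "carrier ?M = ultrapower_set I U (carrier L)"
    by (simp add: ultrapower_gorder_def)
  show ?thesis
  proof (rule greatest_LowerI)
    fix x assume "x \<in> {?c \<alpha>, ?c \<beta>}"
    moreover have "?c ?\<gamma> \<sqsubseteq>\<^bsub>?M\<^esub> ?c \<alpha>"
      unfolding ultrapower_gorder_le[OF \<gamma> \<alpha>]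
      by (rule upI[OF whole]) (use mem L.meet_left in auto)
    moreover have "?c ?\<gamma> \<sqsubseteq>\<^bsub>?M\<^esub> ?c \<beta>"
      unfolding ultrapower_gorder_le[OF \<gamma> \<beta>]
      by (rule upI[OF whole]) (use mem L.meet_right in auto)
    ultimately show "?c ?\<gamma> \<sqsubseteq>\<^bsub>?M\<^esub> x" by auto
  next
    fix y assume "y \<in> Lower ?M {?c \<alpha>, ?c \<beta>}"
    then have y: "y \<in> carrier ?M" "y \<sqsubseteq>\<^bsub>?M\<^esub> ?c \<alpha>" "y \<sqsubseteq>\<^bsub>?M\<^esub> ?c \<beta>"
      using ultra_class_in[OF \<alpha>] ultra_class_in[OF \<beta>] by (auto simp: Lower_def c)
    from y(1) obtain h where h: "h \<in> I \<rightarrow>\<^sub>E carrier L" "y = ?c h"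
      unfolding c by (rule ultrapower_setE)
    show "y \<sqsubseteq>\<^bsub>?M\<^esub> ?c ?\<gamma>"
      using y(2,3) unfolding h(2) ultrapower_gorder_le[OF h(1) \<alpha>]
        ultrapower_gorder_le[OF h(1) \<beta>] ultrapower_gorder_le[OF h(1) \<gamma>]
      by (rule up2I) (use h(1) mem in \<open>auto intro!: L.meet_le\<close>)
  qed (simp_all add: c ultra_class_in[OF \<alpha>] ultra_class_in[OF \<beta>] ultra_class_in[OF \<gamma>])
qed

lemma lattice_ultrapower_gorder:
  assumes "lattice L"
  shows "lattice (ultrapower_gorder I U L)"
proof -
  interpret L: lattice L by fact
  interpret M: partial_order "ultrapower_gorder I U L"
    by (rule partial_order_ultrapower_gorder) (rule L.partial_order_axioms)
  have c: "carrier (ultrapower_gorder I U L) = ultrapower_set I U (carrier L)"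
    by (simp add: ultrapower_gorder_def)
  show ?thesis
  proof (unfold_locales, unfold c)
    fix x y assume xy: "x \<in> ultrapower_set I U (carrier L)" "y \<in> ultrapower_set I U (carrier L)"
    obtain f where f: "f \<in> I \<rightarrow>\<^sub>E carrier L" "x = ultra_class I U (carrier L) f"
      using xy(1) by (rule ultrapower_setE)
    obtain g where g: "g \<in> I \<rightarrow>\<^sub>E carrier L" "y = ultra_class I U (carrier L) g"
      using xy(2) by (rule ultrapower_setE)
    show "\<exists>s. is_lub (ultrapower_gorder I U L) s {x, y}"
      unfolding f(2) g(2) by (rule exI) (rule ultrapower_gorder_is_lub[OF assms f(1) g(1)])
    show "\<exists>s. is_glb (ultrapower_gorder I U L) s {x, y}"
      unfolding f(2) g(2) by (rule exI) (rule ultrapower_gorder_is_glb[OF assms f(1) g(1)])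
  qed
qed

lemma ultrapower_gorder_join:
  assumes "lattice L" and \<alpha>: "\<alpha> \<in> I \<rightarrow>\<^sub>E carrier L" and \<beta>: "\<beta> \<in> I \<rightarrow>\<^sub>E carrier L"
  shows "ultra_class I U (carrier L) \<alpha> \<squnion>\<^bsub>ultrapower_gorder I U L\<^esub> ultra_class I U (carrier L) \<beta> =
           ultra_class I U (carrier L) (\<lambda>i\<in>I. \<alpha> i \<squnion>\<^bsub>L\<^esub> \<beta> i)"
proof -
  interpret M: lattice "ultrapower_gorder I U L"
    by (rule lattice_ultrapower_gorder) fact
  show ?thesis
    unfolding join_def[of "ultrapower_gorder I U L"] sup_def[of "ultrapower_gorder I U L"]
    by (rule some_equality, rule ultrapower_gorder_is_lub[OF assms])
      (rule M.least_unique[OF _ ultrapower_gorder_is_lub[OF assms]])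
qed

lemma ultrapower_gorder_meet:
  assumes "lattice L" and \<alpha>: "\<alpha> \<in> I \<rightarrow>\<^sub>E carrier L" and \<beta>: "\<beta> \<in> I \<rightarrow>\<^sub>E carrier L"
  shows "ultra_class I U (carrier L) \<alpha> \<sqinter>\<^bsub>ultrapower_gorder I U L\<^esub> ultra_class I U (carrier L) \<beta> =
           ultra_class I U (carrier L) (\<lambda>i\<in>I. \<alpha> i \<sqinter>\<^bsub>L\<^esub> \<beta> i)"
proof -
  interpret M: lattice "ultrapower_gorder I U L"
    by (rule lattice_ultrapower_gorder) fact
  show ?thesis
    unfolding meet_def[of "ultrapower_gorder I U L"] inf_def[of "ultrapower_gorder I U L"]
    by (rule some_equality, rule ultrapower_gorder_is_glb[OF assms])
      (rule M.greatest_unique[OF _ ultrapower_gorder_is_glb[OF assms]])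
qed

end

end

theory Submission
  imports Defs
begin

text \<open>An order embedding with join-dense and meet-dense image preserves all existing joins and
  meets, so only order reflection and density need proof. An element \<open>m\<close> of \<open>(P\<^sup>U)\<^sup>+\<close> is the
  union of the sets \<open>\<theta>(i \<mapsto> \<lambda>\<rho>{f i})\<close> over \<open>f\<^sup>U \<in> m\<close>, and the intersection of the sets
  \<open>\<theta>(i \<mapsto> \<lambda>{g i})\<close> over \<open>g\<^sup>U \<in> \<rho> m\<close>. Stability of \<open>\<theta>(\<alpha>\<^sup>U)\<close> and order
  reflection follow by choosing witnesses coordinatewise on a set in \<open>U\<close>.\<close>

section \<open>Order embeddings with dense image\<close>

text \<open>An upper bound \<open>m\<close> of the image of \<open>A\<close> is a meet of elements
  \<open>e t\<close>, so it suffices to put \<open>e s\<close> below each of these. Preservation of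
  joins thus rests on density under meets.\<close>

lemma is_lub_image:
  assumes M: "partial_order M" and e: "e \<in> carrier L \<rightarrow> carrier M"
    and emb: "\<And>x y. x \<in> carrier L \<Longrightarrow> y \<in> carrier L \<Longrightarrow> e x \<sqsubseteq>\<^bsub>M\<^esub> e y \<longleftrightarrow> x \<sqsubseteq>\<^bsub>L\<^esub> y"
    and dense: "\<And>m. m \<in> carrier M \<Longrightarrow> \<exists>S\<subseteq>e ` carrier L. is_glb M m S"
    and A: "A \<subseteq> carrier L" and s: "is_lub L s A"
  shows "is_lub M (e s) (e ` A)"
proof (rule least_UpperI)
  interpret M: partial_order M by fact
  have sc: "s \<in> carrier L"
    using s by (rule least_closed)
  show "e s \<in> carrier M"
    using sc e by auto
  show "e ` A \<subseteq> carrier M"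
    using A e by auto
  show "x \<sqsubseteq>\<^bsub>M\<^esub> e s" if "x \<in> e ` A" for x
    using that A emb sc least_Upper_above[OF s _ A] by auto
  fix m assume m: "m \<in> Upper M (e ` A)"
  then have mc: "m \<in> carrier M"
    by (simp add: Upper_def)
  then obtain S where S: "S \<subseteq> e ` carrier L" and glb: "is_glb M m S"
    using dense by blast
  have SM: "S \<subseteq> carrier M"
    using S e by auto
  have "e s \<sqsubseteq>\<^bsub>M\<^esub> y" if y: "y \<in> S" for y
  proof -
    from y S obtain t where t: "t \<in> carrier L" "y = e t"
      by auto
    \<comment> \<open>\<open>e a\<close> lies below \<open>m\<close> and \<open>m\<close> below
      \<open>e t\<close>; order reflection pulls this back to \<open>L\<close>, where
      \<open>t\<close> becomes an upper bound of \<open>A\<close> and so lies above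
      \<open>s\<close>.\<close>
    have "a \<sqsubseteq>\<^bsub>L\<^esub> t" if a: "a \<in> A" for a
    proof -
      have ac: "a \<in> carrier L" "e a \<in> carrier M" "e t \<in> carrier M"
        using a A e t by auto
      have "e a \<sqsubseteq>\<^bsub>M\<^esub> m"
        using m a \<open>e ` A \<subseteq> carrier M\<close> by (auto simp: Upper_def)
      moreover have "m \<sqsubseteq>\<^bsub>M\<^esub> e t"
        using greatest_Lower_below[OF glb y SM] t by simp
      ultimately have "e a \<sqsubseteq>\<^bsub>M\<^esub> e t"
        using M.le_trans ac mc by blast
      then show ?thesis
        using emb ac t by blast
    qed
    then have "t \<in> Upper L A"
      using t A by (auto simp: Upper_def)
    then have "s \<sqsubseteq>\<^bsub>L\<^esub> t"
      using s by (auto dest: least_le)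
    then show ?thesis
      using emb sc t by blast
  qed
  then have "e s \<in> Lower M S"
    using \<open>e s \<in> carrier M\<close> by (auto simp: Lower_def)
  then show "e s \<sqsubseteq>\<^bsub>M\<^esub> m"
    using glb by (auto dest: greatest_le)
qed

text \<open>Inverting both orders exchanges lubs with glbs, so here density under joins takes over
  the role of density under meets.\<close>

lemma is_glb_image:
  assumes M: "partial_order M" and e: "e \<in> carrier L \<rightarrow> carrier M"
    and emb: "\<And>x y. x \<in> carrier L \<Longrightarrow> y \<in> carrier L \<Longrightarrow> e x \<sqsubseteq>\<^bsub>M\<^esub> e y \<longleftrightarrow> x \<sqsubseteq>\<^bsub>L\<^esub> y"
    and dense: "\<And>m. m \<in> carrier M \<Longrightarrow> \<exists>S\<subseteq>e ` carrier L. is_lub M m S"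
    and A: "A \<subseteq> carrier L" and s: "is_glb L s A"
  shows "is_glb M (e s) (e ` A)"
  using is_lub_image[of "inv_gorder M" e "inv_gorder L" A s] assms
  by (simp add: partial_order.dual_order)

text \<open>Binary joins and meets are lubs and glbs of pairs, so their preservation follows from
  the two image lemmas and uniqueness of bounds. Injectivity follows from order reflection and
  antisymmetry.\<close>

lemma MacNeille_completionI:
  assumes L: "lattice L" and M: "complete_lattice M" and e: "e \<in> carrier L \<rightarrow> carrier M"
    and emb: "\<And>x y. x \<in> carrier L \<Longrightarrow> y \<in> carrier L \<Longrightarrow> e x \<sqsubseteq>\<^bsub>M\<^esub> e y \<longleftrightarrow> x \<sqsubseteq>\<^bsub>L\<^esub> y"
    and meet_dense: "\<And>m. m \<in> carrier M \<Longrightarrow> \<exists>S\<subseteq>e ` carrier L. is_glb M m S"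
    and join_dense: "\<And>m. m \<in> carrier M \<Longrightarrow> \<exists>S\<subseteq>e ` carrier L. is_lub M m S"
  shows "MacNeille_completion L M e"
proof -
  interpret L: lattice L by fact
  interpret M: complete_lattice M by fact
  have M': "partial_order M" "lattice M"
    by unfold_locales
  have "inj_on e (carrier L)"
  proof (rule inj_onI)
    fix x y assume xy: "x \<in> carrier L" "y \<in> carrier L" "e x = e y"
    then have "e x \<sqsubseteq>\<^bsub>M\<^esub> e y" "e y \<sqsubseteq>\<^bsub>M\<^esub> e x"
      using e by auto
    then show "x = y"
      using xy emb L.le_antisym by blast
  qed
  moreover have "e (x \<squnion>\<^bsub>L\<^esub> y) = e x \<squnion>\<^bsub>M\<^esub> e y" if xy: "x \<in> carrier L" "y \<in> carrier L" for x y
  proof -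
    have "is_lub L (x \<squnion>\<^bsub>L\<^esub> y) {x, y}"
      unfolding join_def using xy by (rule L.sup_of_two_least)
    then have "is_lub M (e (x \<squnion>\<^bsub>L\<^esub> y)) {e x, e y}"
      using is_lub_image[OF M'(1) e emb meet_dense, of "{x, y}"] xy by simp
    moreover have "is_lub M (e x \<squnion>\<^bsub>M\<^esub> e y) {e x, e y}"
      unfolding join_def using xy e by (intro M.sup_of_two_least) auto
    ultimately show ?thesis
      by (rule M.least_unique)
  qed
  moreover have "e (x \<sqinter>\<^bsub>L\<^esub> y) = e x \<sqinter>\<^bsub>M\<^esub> e y" if xy: "x \<in> carrier L" "y \<in> carrier L" for x y
  proof -
    have "is_glb L (x \<sqinter>\<^bsub>L\<^esub> y) {x, y}"
      unfolding meet_def using xy by (rule L.inf_of_two_greatest)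
    then have "is_glb M (e (x \<sqinter>\<^bsub>L\<^esub> y)) {e x, e y}"
      using is_glb_image[OF M'(1) e emb join_dense, of "{x, y}"] xy by simp
    moreover have "is_glb M (e x \<sqinter>\<^bsub>M\<^esub> e y) {e x, e y}"
      unfolding meet_def using xy e by (intro M.inf_of_two_greatest) auto
    ultimately show ?thesis
      by (rule M.greatest_unique)
  qed
  ultimately show ?thesis
    using assms M'
    by (simp add: MacNeille_completion_def lattice_embedding_def join_pres_def meet_pres_def)
qed

section \<open>The complete lattice of stable sets\<close>

lemma stable_lattice_simps [simp]:
  "carrier (stable_lattice P) = {A. stable P A}"
  "eq (stable_lattice P) = (=)"
  "A \<sqsubseteq>\<^bsub>stable_lattice P\<^esub> B \<longleftrightarrow> A \<subseteq> B"
  by (simp_all add: stable_lattice_def)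

text \<open>The Galois identity: \<open>lam\<close>, \<open>rho\<close>, \<open>lam\<close> in
  succession amount to a single \<open>lam\<close>.\<close>

lemma stable_lam: "B \<subseteq> Yset P \<Longrightarrow> stable P (lam P B)"
  by (auto simp: stable_def lam_def rho_def)

lemma rho_subset: "rho P A \<subseteq> Yset P"
  by (auto simp: rho_def)

text \<open>A subset of \<open>Xset P\<close> always lies in its closure, so only the points outside
  it need attention: each must fail against some \<open>y\<close> in \<open>rho P A\<close>. This
  existential form, with converse \<open>stable_separate\<close>, suits a choice of witnesses
  coordinate by coordinate.\<close>

lemma stableI:
  assumes "A \<subseteq> Xset P"
    and "\<And>x. x \<in> Xset P \<Longrightarrow> x \<notin> A \<Longrightarrow> \<exists>y\<in>rho P A. (x, y) \<notin> Rel P"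
  shows "stable P A"
  using assms by (auto simp: stable_def lam_def rho_def)

lemma stable_separate:
  assumes "stable P A" "x \<in> Xset P" "x \<notin> A"
  shows "\<exists>y\<in>rho P A. (x, y) \<notin> Rel P"
  using assms unfolding stable_def lam_def by blast

lemma partial_order_stable_lattice: "partial_order (stable_lattice P)"
  by unfold_locales auto

text \<open>For families whose join needs no closure, as in the proof of join-density.\<close>

lemma is_lub_stable_UnionI:
  "stable P (\<Union>G) \<Longrightarrow> \<forall>A\<in>G. stable P A \<Longrightarrow> is_lub (stable_lattice P) (\<Union>G) G"
  by (rule least_UpperI) (auto simp: Upper_def)

text \<open>Intersecting with \<open>Xset P\<close> gives the right value for empty \<open>G\<close>.\<close>

lemma is_glb_stable_Inter:
  assumes "\<forall>A\<in>G. stable P A"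
  shows "is_glb (stable_lattice P) (Xset P \<inter> \<Inter>G) G"
proof (rule greatest_LowerI)
  have "stable P (Xset P \<inter> \<Inter>G)"
  proof (rule stableI)
    fix x assume x: "x \<in> Xset P" "x \<notin> Xset P \<inter> \<Inter>G"
    then obtain A where A: "A \<in> G" "x \<notin> A" by auto
    with assms x obtain y where "y \<in> rho P A" "(x, y) \<notin> Rel P"
      using stable_separate by metis
    \<comment> \<open>\<open>rho\<close> reverses inclusion, so \<open>y\<close> stays in
      \<open>rho\<close> of the smaller intersection.\<close>
    with A show "\<exists>y\<in>rho P (Xset P \<inter> \<Inter>G). (x, y) \<notin> Rel P"
      by (auto simp: rho_def)
  qed auto
  then show "Xset P \<inter> \<Inter>G \<in> carrier (stable_lattice P)"
    by simp
next
  show "B \<sqsubseteq>\<^bsub>stable_lattice P\<^esub> Xset P \<inter> \<Inter>G" if "B \<in> Lower (stable_lattice P) G" for B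
    using that assms by (auto simp: Lower_def stable_def[of P B])
qed (use assms in auto)

lemma is_lub_stable:
  assumes "\<forall>A\<in>G. stable P A"
  shows "is_lub (stable_lattice P) (lam P (rho P (\<Union>G))) G"
proof (rule least_UpperI)
  show "lam P (rho P (\<Union>G)) \<sqsubseteq>\<^bsub>stable_lattice P\<^esub> B" if "B \<in> Upper (stable_lattice P) G" for B
  proof -
    have B: "stable P B" "\<Union>G \<subseteq> B"
      using that assms by (auto simp: Upper_def)
    \<comment> \<open>\<open>rho\<close> and \<open>lam\<close> both reverse inclusion, so the
      closure is monotone; it fixes \<open>B\<close> by stability.\<close>
    then have "lam P (rho P (\<Union>G)) \<subseteq> lam P (rho P B)"
      by (fastforce simp: lam_def rho_def)
    then show ?thesis
      using B by (simp add: stable_def)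
  qed
qed (use assms in \<open>auto simp: stable_lam[OF rho_subset]\<close>, auto simp: stable_def lam_def rho_def)

lemma complete_lattice_stable_lattice: "complete_lattice (stable_lattice P)"
proof -
  interpret partial_order "stable_lattice P"
    by (rule partial_order_stable_lattice)
  show ?thesis
  proof
    fix G assume "G \<subseteq> carrier (stable_lattice P)"
    then have G: "\<forall>A\<in>G. stable P A" by auto
    show "\<exists>s. is_lub (stable_lattice P) s G"
      using is_lub_stable[OF G] by blast
    show "\<exists>s. is_glb (stable_lattice P) s G"
      using is_glb_stable_Inter[OF G] by blast
  qed
qed

section \<open>Negation, choice and \<open>rho\<close> in ultrapowers\<close>

context ultrafilter_on
begin

text \<open>By \<open>ultra\<close> one of two complementary sets is in \<open>U\<close>; if both
  were, so would be their empty intersection.\<close>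

lemma not_in_ultrafilter: "{i \<in> I. Q i} \<notin> U \<longleftrightarrow> {i \<in> I. \<not> Q i} \<in> U"
proof -
  have "I - {i \<in> I. Q i} = {i \<in> I. \<not> Q i}" "{i \<in> I. Q i} \<inter> {i \<in> I. \<not> Q i} = {}"
    by auto
  then show ?thesis
    using ultra[of "{i \<in> I. Q i}"] inter[of "{i \<in> I. Q i}" "{i \<in> I. \<not> Q i}"] proper by auto
qed

text \<open>The existential step of Los's theorem: witnesses on a set in \<open>U\<close> are
  collected into one function, total on \<open>I\<close>.\<close>

lemma ultra_choice:
  assumes "{i \<in> I. \<exists>x\<in>A. Q i x} \<in> U"
  obtains f where "f \<in> I \<rightarrow>\<^sub>E A" "{i \<in> I. Q i (f i)} \<in> U"
proof
  \<comment> \<open>Where no witness exists, the implication holds trivially and an arbitrary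
    element of \<open>A\<close> is taken.\<close>
  let ?f = "\<lambda>i\<in>I. SOME x. x \<in> A \<and> ((\<exists>x\<in>A. Q i x) \<longrightarrow> Q i x)"
  \<comment> \<open>A set in \<open>U\<close> is nonempty, so some coordinate has a witness. Hence
    \<open>A\<close> is nonempty and the default exists at every coordinate.\<close>
  have "{i \<in> I. \<exists>x\<in>A. Q i x} \<noteq> {}"
    using assms proper by metis
  then have "\<exists>x. x \<in> A \<and> ((\<exists>x\<in>A. Q i x) \<longrightarrow> Q i x)" for i
    by blast
  then have f: "?f i \<in> A \<and> ((\<exists>x\<in>A. Q i x) \<longrightarrow> Q i (?f i))" if "i \<in> I" for i
    using that someI_ex[of "\<lambda>x. x \<in> A \<and> ((\<exists>x\<in>A. Q i x) \<longrightarrow> Q i x)"] by simp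
  then show "?f \<in> I \<rightarrow>\<^sub>E A"
    by auto
  show "{i \<in> I. Q i (?f i)} \<in> U"
    using assms by (rule upI) (use f in blast)
qed

lemma ultrapower_polarity_simps [simp]:
  "Xset (ultrapower_polarity I U P) = ultrapower_set I U (Xset P)"
  "Yset (ultrapower_polarity I U P) = ultrapower_set I U (Yset P)"
  by (simp_all add: ultrapower_polarity_def)

lemma carrier_ultrapower_gorder [simp]:
  "carrier (ultrapower_gorder I U L) = ultrapower_set I U (carrier L)"
  by (simp add: ultrapower_gorder_def)

text \<open>Lets membership in \<open>rho\<close> be tested on representatives; the inclusion
  assumed of \<open>m\<close> supplies one for each of its elements.\<close>

lemma ultra_class_in_rho:
  assumes "g \<in> I \<rightarrow>\<^sub>E Yset P" "m \<subseteq> ultrapower_set I U (Xset P)"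
  shows "ultra_class I U (Yset P) g \<in> rho (ultrapower_polarity I U P) m \<longleftrightarrow>
    (\<forall>f \<in> I \<rightarrow>\<^sub>E Xset P. ultra_class I U (Xset P) f \<in> m \<longrightarrow> {i \<in> I. (f i, g i) \<in> Rel P} \<in> U)"
    (is "_ \<longleftrightarrow> ?r")
proof
  assume ?r
  have "(x, ultra_class I U (Yset P) g) \<in> Rel (ultrapower_polarity I U P)" if x: "x \<in> m" for x
  proof -
    from x assms(2) obtain f where f: "f \<in> I \<rightarrow>\<^sub>E Xset P" "x = ultra_class I U (Xset P) f"
      by (blast elim: ultrapower_setE)
    then show ?thesis
      using \<open>?r\<close> x assms(1) by (simp add: ultrapower_polarity_Rel)
  qed
  then show "ultra_class I U (Yset P) g \<in> rho (ultrapower_polarity I U P) m"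
    using ultra_class_in[OF assms(1)] by (simp add: rho_def)
qed (use assms(1) in \<open>auto simp: rho_def ultrapower_polarity_Rel\<close>)

section \<open>Stability of the images of \<open>theta\<close> and the order embedding\<close>

lemma theta_subset: "theta I U P a \<subseteq> ultrapower_set I U (Xset P)"
  by (auto simp: theta_def intro: ultra_class_in)

text \<open>If the class of \<open>f\<close> is outside, then on a set in \<open>U\<close> the point
  \<open>f i\<close> is outside \<open>\<alpha> i\<close>, and some \<open>g i\<close> in
  \<open>rho P (\<alpha> i)\<close> is not related to it. The class of \<open>g\<close> is the
  separating element.\<close>

lemma stable_theta:
  assumes \<alpha>: "\<alpha> \<in> I \<rightarrow>\<^sub>E carrier (stable_lattice P)"
  shows "stable (ultrapower_polarity I U P)
           (theta I U P (ultra_class I U (carrier (stable_lattice P)) \<alpha>))"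
    (is "stable ?Q ?T")
proof (rule stableI)
  show "?T \<subseteq> Xset ?Q"
    using theta_subset by simp
  fix x assume "x \<in> Xset ?Q" and nx: "x \<notin> ?T"
  then obtain f where f: "f \<in> I \<rightarrow>\<^sub>E Xset P" "x = ultra_class I U (Xset P) f"
    by (auto elim: ultrapower_setE)
  from nx have "{i \<in> I. f i \<notin> \<alpha> i} \<in> U"
    unfolding f(2) theta_mem_iff[OF \<alpha> f(1)] not_in_ultrafilter .
  \<comment> \<open>\<open>ultra_choice\<close> asks for one range common to all coordinates;
    \<open>rho P (\<alpha> i)\<close> varies with \<open>i\<close>, so it moves into the
    property.\<close>
  then have "{i \<in> I. \<exists>y\<in>Yset P. y \<in> rho P (\<alpha> i) \<and> (f i, y) \<notin> Rel P} \<in> U"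
  proof (rule upI)
    fix i assume i: "i \<in> {i \<in> I. f i \<notin> \<alpha> i}" "i \<in> I"
    then have "stable P (\<alpha> i)" "f i \<in> Xset P"
      using PiE_mem[OF \<alpha>] PiE_mem[OF f(1)] by auto
    with i show "\<exists>y\<in>Yset P. y \<in> rho P (\<alpha> i) \<and> (f i, y) \<notin> Rel P"
      using stable_separate[of P "\<alpha> i" "f i"] rho_subset[of P "\<alpha> i"] by blast
  qed
  then obtain g where g: "g \<in> I \<rightarrow>\<^sub>E Yset P"
    and gi: "{i \<in> I. g i \<in> rho P (\<alpha> i) \<and> (f i, g i) \<notin> Rel P} \<in> U"
    by (rule ultra_choice)
  have "{i \<in> I. (f i, g i) \<notin> Rel P} \<in> U"
    using gi by (rule upI) auto
  then have "(x, ultra_class I U (Yset P) g) \<notin> Rel ?Q"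
    unfolding f(2) ultrapower_polarity_Rel[OF f(1) g] not_in_ultrafilter .
  \<comment> \<open>\<open>h i\<close> is in \<open>\<alpha> i\<close> and \<open>g i\<close> in
    \<open>rho P (\<alpha> i)\<close> simultaneously on a set in \<open>U\<close>.\<close>
  moreover have "{i \<in> I. (h i, g i) \<in> Rel P} \<in> U"
    if "h \<in> I \<rightarrow>\<^sub>E Xset P" "ultra_class I U (Xset P) h \<in> ?T" for h
    using that(2) gi unfolding theta_mem_iff[OF \<alpha> that(1)]
    by (rule up2I) (auto simp: rho_def)
  then have "ultra_class I U (Yset P) g \<in> rho ?Q ?T"
    using ultra_class_in_rho[OF g theta_subset] by blast
  ultimately show "\<exists>y\<in>rho ?Q ?T. (x, y) \<notin> Rel ?Q"
    by blast
qed

text \<open>If inclusion fails on a set in \<open>U\<close>, points chosen in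
  \<open>\<alpha> i\<close> outside \<open>\<beta> i\<close> form a class that belongs to the first
  image but not to the second.\<close>

lemma theta_subset_iff:
  assumes \<alpha>: "\<alpha> \<in> I \<rightarrow>\<^sub>E carrier (stable_lattice P)" and \<beta>: "\<beta> \<in> I \<rightarrow>\<^sub>E carrier (stable_lattice P)"
  shows "theta I U P (ultra_class I U (carrier (stable_lattice P)) \<alpha>) \<subseteq>
           theta I U P (ultra_class I U (carrier (stable_lattice P)) \<beta>)
         \<longleftrightarrow> {i \<in> I. \<alpha> i \<subseteq> \<beta> i} \<in> U" (is "?T \<alpha> \<subseteq> ?T \<beta> \<longleftrightarrow> _")
proof
  assume le: "{i \<in> I. \<alpha> i \<subseteq> \<beta> i} \<in> U"
  have "{i \<in> I. f i \<in> \<beta> i} \<in> U" if "{i \<in> I. f i \<in> \<alpha> i} \<in> U" for f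
    using that le by (rule up2I) auto
  then show "?T \<alpha> \<subseteq> ?T \<beta>"
    unfolding theta_class[OF \<alpha>] theta_class[OF \<beta>] by blast
next
  assume sub: "?T \<alpha> \<subseteq> ?T \<beta>"
  show "{i \<in> I. \<alpha> i \<subseteq> \<beta> i} \<in> U"
  proof (rule ccontr)
    assume "{i \<in> I. \<alpha> i \<subseteq> \<beta> i} \<notin> U"
    then have "{i \<in> I. \<not> \<alpha> i \<subseteq> \<beta> i} \<in> U"
      unfolding not_in_ultrafilter .
    \<comment> \<open>Stable sets lie in \<open>Xset P\<close>, which serves as the common range for
      the choice.\<close>
    then have "{i \<in> I. \<exists>x\<in>Xset P. x \<in> \<alpha> i \<and> x \<notin> \<beta> i} \<in> U"
      by (rule upI) (use \<alpha> in \<open>fastforce simp: stable_def dest: PiE_mem\<close>)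
    then obtain f where f: "f \<in> I \<rightarrow>\<^sub>E Xset P" and fi: "{i \<in> I. f i \<in> \<alpha> i \<and> f i \<notin> \<beta> i} \<in> U"
      by (rule ultra_choice)
    have "{i \<in> I. f i \<in> \<alpha> i} \<in> U" "{i \<in> I. f i \<notin> \<beta> i} \<in> U"
      using upI[OF fi] by auto
    then show False
      using sub theta_mem_iff[OF \<alpha> f] theta_mem_iff[OF \<beta> f] not_in_ultrafilter[of "\<lambda>i. f i \<in> \<beta> i"]
      by blast
  qed
qed

section \<open>Meet-density and join-density of the image\<close>

lemma theta_meet_dense:
  fixes P :: "('a, 'b) polarity"
  assumes m: "stable (ultrapower_polarity I U P) m"
  shows "\<exists>S\<subseteq>theta I U P ` ultrapower_set I U (carrier (stable_lattice P)).
           is_glb (stable_lattice (ultrapower_polarity I U P)) m S"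
proof -
  let ?Q = "ultrapower_polarity I U P"
  let ?c = "ultra_class I U (carrier (stable_lattice P))"
  \<comment> \<open>The coordinatewise form of \<open>lam\<close> of a singleton: by
    \<open>mem\<close> below, \<open>theta\<close> sends its class to the set of points related to
    the class of \<open>g\<close>.\<close>
  define \<alpha> where "\<alpha> g = (\<lambda>i\<in>I. lam P {g i})" for g :: "_ \<Rightarrow> 'b"
  define S where
    "S = {theta I U P (?c (\<alpha> g)) | g. g \<in> I \<rightarrow>\<^sub>E Yset P \<and> ultra_class I U (Yset P) g \<in> rho ?Q m}"
  have \<alpha>: "\<alpha> g \<in> I \<rightarrow>\<^sub>E carrier (stable_lattice P)" if "g \<in> I \<rightarrow>\<^sub>E Yset P" for g
    using that PiE_mem[OF that] by (auto simp: \<alpha>_def intro!: stable_lam)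
  have mem: "ultra_class I U (Xset P) f \<in> theta I U P (?c (\<alpha> g)) \<longleftrightarrow>
      (ultra_class I U (Xset P) f, ultra_class I U (Yset P) g) \<in> Rel ?Q"
    if f: "f \<in> I \<rightarrow>\<^sub>E Xset P" and g: "g \<in> I \<rightarrow>\<^sub>E Yset P" for f g
  proof -
    have "{i \<in> I. f i \<in> \<alpha> g i} = {i \<in> I. (f i, g i) \<in> Rel P}"
      using PiE_mem[OF f] by (auto simp: \<alpha>_def lam_def)
    then show ?thesis
      unfolding theta_mem_iff[OF \<alpha>[OF g] f] ultrapower_polarity_Rel[OF f g] by simp
  qed
  have mX: "m \<subseteq> Xset ?Q" and lam: "lam ?Q (rho ?Q m) = m"
    using m by (simp_all add: stable_def)
  \<comment> \<open>The comparison is confined to \<open>Xset ?Q\<close> because \<open>S\<close>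
    may be empty, and then its intersection is the whole type.\<close>
  have "x \<in> m \<longleftrightarrow> x \<in> \<Inter>S" if x: "x \<in> Xset ?Q" for x
  proof -
    from x obtain f where f: "f \<in> I \<rightarrow>\<^sub>E Xset P" "x = ultra_class I U (Xset P) f"
      by (auto elim: ultrapower_setE)
    have "x \<in> m \<longleftrightarrow> (\<forall>y\<in>rho ?Q m. (x, y) \<in> Rel ?Q)"
    proof -
      have "x \<in> m \<longleftrightarrow> x \<in> lam ?Q (rho ?Q m)"
        by (simp only: lam)
      then show ?thesis
        using x by (simp add: lam_def)
    qed
    \<comment> \<open>Each element of \<open>rho ?Q m\<close> is the class of some \<open>g\<close>;
      quantifying over representatives matches the indexing of \<open>S\<close>.\<close>
    also have "\<dots> \<longleftrightarrow> (\<forall>g\<in>I \<rightarrow>\<^sub>E Yset P. ultra_class I U (Yset P) g \<in> rho ?Q m \<longrightarrow>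
        (x, ultra_class I U (Yset P) g) \<in> Rel ?Q)"
    proof (intro iffI ballI impI)
      fix y assume y: "y \<in> rho ?Q m"
        and R: "\<forall>g\<in>I \<rightarrow>\<^sub>E Yset P. ultra_class I U (Yset P) g \<in> rho ?Q m \<longrightarrow>
          (x, ultra_class I U (Yset P) g) \<in> Rel ?Q"
      have "y \<in> ultrapower_set I U (Yset P)"
        using y rho_subset[of ?Q m] by auto
      then obtain g where "g \<in> I \<rightarrow>\<^sub>E Yset P" "y = ultra_class I U (Yset P) g"
        by (rule ultrapower_setE)
      with R y show "(x, y) \<in> Rel ?Q"
        by simp
    qed simp
    also have "\<dots> \<longleftrightarrow> x \<in> \<Inter>S"
      using mem[OF f(1)] unfolding S_def f(2) by blast
    finally show ?thesis .
  qed
  then have "m = Xset ?Q \<inter> \<Inter>S"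
    using mX by blast
  moreover have "\<forall>A\<in>S. stable ?Q A"
    using stable_theta[OF \<alpha>] unfolding S_def by blast
  ultimately have "is_glb (stable_lattice ?Q) m S"
    using is_glb_stable_Inter[of S ?Q] by simp
  moreover have "S \<subseteq> theta I U P ` ultrapower_set I U (carrier (stable_lattice P))"
    using ultra_class_in[OF \<alpha>] unfolding S_def by blast
  ultimately show ?thesis
    by blast
qed

text \<open>Every class in \<open>m\<close> lies in the image generated by it (\<open>ge\<close>),
  and that image stays inside \<open>m\<close> (\<open>le\<close>). So \<open>m\<close> is a plain
  union, and its stability makes it the join.\<close>

lemma theta_join_dense:
  fixes P :: "('a, 'b) polarity"
  assumes m: "stable (ultrapower_polarity I U P) m"
  shows "\<exists>S\<subseteq>theta I U P ` ultrapower_set I U (carrier (stable_lattice P)).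
           is_lub (stable_lattice (ultrapower_polarity I U P)) m S"
proof -
  let ?Q = "ultrapower_polarity I U P"
  let ?c = "ultra_class I U (carrier (stable_lattice P))"
  \<comment> \<open>For \<open>f i\<close> in \<open>Xset P\<close>, this is the least stable set
    containing \<open>f i\<close>.\<close>
  define \<alpha> where "\<alpha> f = (\<lambda>i\<in>I. lam P (rho P {f i}))" for f :: "_ \<Rightarrow> 'a"
  define S where
    "S = {theta I U P (?c (\<alpha> f)) | f. f \<in> I \<rightarrow>\<^sub>E Xset P \<and> ultra_class I U (Xset P) f \<in> m}"
  have mX: "m \<subseteq> ultrapower_set I U (Xset P)"
    using m by (simp add: stable_def)
  have \<alpha>: "\<alpha> f \<in> I \<rightarrow>\<^sub>E carrier (stable_lattice P)" for f
    by (auto simp: \<alpha>_def stable_lam[OF rho_subset])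
  have S: "\<forall>A\<in>S. stable ?Q A"
    using stable_theta[OF \<alpha>] unfolding S_def by blast
  have le: "theta I U P (?c (\<alpha> f)) \<subseteq> m"
    if f: "f \<in> I \<rightarrow>\<^sub>E Xset P" "ultra_class I U (Xset P) f \<in> m" for f
  proof
    fix x assume "x \<in> theta I U P (?c (\<alpha> f))"
    then obtain h where h: "h \<in> I \<rightarrow>\<^sub>E Xset P" "x = ultra_class I U (Xset P) h"
      and hi: "{i \<in> I. h i \<in> \<alpha> f i} \<in> U"
      unfolding theta_class[OF \<alpha>] by blast
    have "(x, y) \<in> Rel ?Q" if y: "y \<in> rho ?Q m" for y
    proof -
      have "y \<in> ultrapower_set I U (Yset P)"
        using y rho_subset[of ?Q m] by auto
      then obtain g where g: "g \<in> I \<rightarrow>\<^sub>E Yset P" "y = ultra_class I U (Yset P) g"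
        by (rule ultrapower_setE)
      have "{i \<in> I. (f i, g i) \<in> Rel P} \<in> U"
        using y f unfolding g(2) ultra_class_in_rho[OF g(1) mX] by blast
      \<comment> \<open>A point of \<open>lam P (rho P {f i})\<close> is related to every
        \<open>y\<close> in \<open>Yset P\<close> to which \<open>f i\<close> is related, so the
        relation to \<open>g i\<close> passes from \<open>f i\<close> to \<open>h i\<close>.\<close>
      with hi have "{i \<in> I. (h i, g i) \<in> Rel P} \<in> U"
        by (rule up2I) (use PiE_mem[OF g(1)] in \<open>auto simp: \<alpha>_def lam_def rho_def\<close>)
      then show ?thesis
        unfolding h(2) g(2) ultrapower_polarity_Rel[OF h(1) g(1)] .
    qed
    moreover have "x \<in> Xset ?Q"
      using h ultra_class_in by simp
    ultimately have "x \<in> lam ?Q (rho ?Q m)"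
      by (simp add: lam_def)
    then show "x \<in> m"
      using m by (simp add: stable_def)
  qed
  have ge: "ultra_class I U (Xset P) f \<in> theta I U P (?c (\<alpha> f))"
    if f: "f \<in> I \<rightarrow>\<^sub>E Xset P" for f
    unfolding theta_mem_iff[OF \<alpha> f]
    by (rule upI[OF whole]) (use PiE_mem[OF f] in \<open>auto simp: \<alpha>_def lam_def rho_def\<close>)
  have "\<Union>S = m"
  proof
    show "\<Union>S \<subseteq> m"
      using le by (auto simp only: S_def)
    show "m \<subseteq> \<Union>S"
    proof
      fix x assume x: "x \<in> m"
      then have "x \<in> ultrapower_set I U (Xset P)"
        using mX by blast
      then obtain f where f: "f \<in> I \<rightarrow>\<^sub>E Xset P" "x = ultra_class I U (Xset P) f"
        by (rule ultrapower_setE)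
      then have "theta I U P (?c (\<alpha> f)) \<in> S"
        using x unfolding S_def by blast
      then show "x \<in> \<Union>S"
        using ge[OF f(1)] f(2) by blast
    qed
  qed
  then have "is_lub (stable_lattice ?Q) m S"
    using is_lub_stable_UnionI[of ?Q S] m S by simp
  moreover have "S \<subseteq> theta I U P ` ultrapower_set I U (carrier (stable_lattice P))"
    using ultra_class_in[OF \<alpha>] unfolding S_def by blast
  ultimately show ?thesis
    by blast
qed

section \<open>\<open>theta\<close> as a MacNeille completion\<close>

lemma MacNeille_completion_theta:
  "MacNeille_completion (ultrapower_gorder I U (stable_lattice P))
     (stable_lattice (ultrapower_polarity I U P)) (theta I U P)"
proof (rule MacNeille_completionI)
  interpret complete_lattice "stable_lattice P"
    by (rule complete_lattice_stable_lattice)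
  show "lattice (ultrapower_gorder I U (stable_lattice P))"
    by (rule lattice_ultrapower_gorder) unfold_locales
next
  show "theta I U P \<in> carrier (ultrapower_gorder I U (stable_lattice P)) \<rightarrow>
      carrier (stable_lattice (ultrapower_polarity I U P))"
    using stable_theta[of _ P] by (auto elim!: ultrapower_setE)
next
  fix x y
  assume xy: "x \<in> carrier (ultrapower_gorder I U (stable_lattice P))"
    "y \<in> carrier (ultrapower_gorder I U (stable_lattice P))"
  obtain \<alpha> where \<alpha>: "\<alpha> \<in> I \<rightarrow>\<^sub>E carrier (stable_lattice P)"
      "x = ultra_class I U (carrier (stable_lattice P)) \<alpha>"
    using xy(1) unfolding carrier_ultrapower_gorder by (rule ultrapower_setE)
  obtain \<beta> where \<beta>: "\<beta> \<in> I \<rightarrow>\<^sub>E carrier (stable_lattice P)"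
      "y = ultra_class I U (carrier (stable_lattice P)) \<beta>"
    using xy(2) unfolding carrier_ultrapower_gorder by (rule ultrapower_setE)
  show "theta I U P x \<sqsubseteq>\<^bsub>stable_lattice (ultrapower_polarity I U P)\<^esub> theta I U P y \<longleftrightarrow>
      x \<sqsubseteq>\<^bsub>ultrapower_gorder I U (stable_lattice P)\<^esub> y"
    \<comment> \<open>On representatives the ultrapower order becomes coordinatewise inclusion on a
      set in \<open>U\<close>.\<close>
    unfolding \<alpha>(2) \<beta>(2) ultrapower_gorder_le[OF \<alpha>(1) \<beta>(1)] stable_lattice_simps(3)
    by (rule theta_subset_iff[OF \<alpha>(1) \<beta>(1)])
next
  fix m assume "m \<in> carrier (stable_lattice (ultrapower_polarity I U P))"
  then have m: "stable (ultrapower_polarity I U P) m" by simp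
  show "\<exists>S\<subseteq>theta I U P ` carrier (ultrapower_gorder I U (stable_lattice P)).
      is_glb (stable_lattice (ultrapower_polarity I U P)) m S"
    using theta_meet_dense[OF m] unfolding carrier_ultrapower_gorder .
  show "\<exists>S\<subseteq>theta I U P ` carrier (ultrapower_gorder I U (stable_lattice P)).
      is_lub (stable_lattice (ultrapower_polarity I U P)) m S"
    using theta_join_dense[OF m] unfolding carrier_ultrapower_gorder .
qed (rule complete_lattice_stable_lattice)

end

theorem theorem6p1:
  fixes P :: "('a, 'b) polarity" and I :: "'i set" and U :: "'i set set"
  assumes "wf_polarity P" and "ultrafilter_on I U"
  shows "MacNeille_completion
           (ultrapower_gorder I U (stable_lattice P))
           (stable_lattice (ultrapower_polarity I U P))
           (theta I U P)"
  using assms(2) by (rule ultrafilter_on.MacNeille_completion_theta)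

end
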